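(* Let $A,B_1,\ldots,B_m$ be nonzero real symmetric $D\times D$ matrices such that for all $c\in\mathbb{R}^m_+$ the matrix $\sum_{i=1}^m c_iB_i-A$ is not positive semidefinite, and suppose that $\Lambda=\operatorname{cone}\{B_1,\ldots,B_m\}$ is pointed and $\Lambda\cap\mathcal{S}_D^+=\{0\}$. Let $\rho\in\mathcal{S}_D^+$ satisfy $$\operatorname{Tr}(\rho B_i)<0\ \text{ for all } i\in\{1,\ldots,m\},\qquad \operatorname{Tr}(-A\rho)<0,\qquad \operatorname{Tr}(\rho)=1 .$$ Set $$\epsilon=\frac16\min\left\{\left|\frac{\operatorname{Tr}(\rho B_1)}{\|B_1\|_1}\right|,\ldots,\left|\frac{\operatorname{Tr}(\rho B_m)}{\|B_m\|_1}\right|,\left|\frac{\operatorname{Tr}(\rho A)}{\|A\|_1}\right|\right\}$$ and let $S$ be a random real $d\times D$ matrix that is an $(\epsilon,\delta,k)$-Johnson-Lindenstrauss transform, where $$k\ \ge\ \operatorname{rank}(A)+\operatorname{rank}(\rho)+\sum_{i=1}^m\operatorname{rank}(B_i).$$ Then, with probability at least $1-\delta$, for all $c\in\mathbb{R}^m_+$ the matrix $$\sum_{i=1}^m c_i\,SB_iS^T-SAS^T$$ is not positive semidefinite.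
   Context: $\mathbb{R}^m_+=\{x\in\mathbb{R}^m: x_i\ge 0\ \text{for all } i\}$. $\mathcal{S}_D^+$ is the cone of real symmetric positive semidefinite $D\times D$ matrices. $\operatorname{cone}\{B_1,\ldots,B_m\}=\{\sum_i c_iB_i: c\in\mathbb{R}^m_+\}$. A convex cone $C$ is pointed if $C\cap(-C)=\{0\}$. $\|A\|_1=\operatorname{Tr}[(A^TA)^{1/2}]$ is the Schatten $1$-norm. A random matrix $S\in\mathbb{R}^{d\times D}$ is a Johnson-Lindenstrauss transform (JLT) with parameters $(\epsilon,\delta,k)$, where $\epsilon>0$ and $\delta\in(0,1)$, if for every fixed $k$-element subset $V\subseteq\mathbb{R}^D$, with probability at least $1-\delta$ it holds that for all $v,w\in V$: $|\langle Sv,Sw\rangle-\langle v,w\rangle|\le\epsilon\|v\|_2\|w\|_2$. *)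

theory Defs
  imports "HOL-Probability.Probability"
begin

definition nonneg_orthant :: "(real^'m) set" where
  "nonneg_orthant = {c. \<forall>i. 0 \<le> c $ i}"

definition psd_cone :: "(real^'n^'n) set" where
  "psd_cone = {P. transpose P = P \<and> (\<forall>x. 0 \<le> x \<bullet> (P *v x))}"

definition matrix_cone :: "('m::finite \<Rightarrow> real^'n^'n) \<Rightarrow> (real^'n^'n) set" where
  "matrix_cone B = {(\<Sum>i\<in>UNIV. c $ i *\<^sub>R B i) | c :: real^'m. c \<in> nonneg_orthant}"

definition pointed :: "'a::real_vector set \<Rightarrow> bool" where
  "pointed C \<longleftrightarrow> C \<inter> uminus ` C = {0}"

(* Used only for P positive semidefinite, where such a root exists and is unique. *)
definition psd_sqrt :: "real^'n^'n \<Rightarrow> real^'n^'n" where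
  "psd_sqrt P = (THE R. R \<in> psd_cone \<and> R ** R = P)"

definition schatten1_norm :: "real^'n^'m \<Rightarrow> real" where
  "schatten1_norm A = trace (psd_sqrt (transpose A ** A))"

(* The set V is fixed before the probability is taken.  As delta < 1 and measure is 0 on
   non-measurable sets, a lower bound 1 - delta on a probability includes measurability of
   the event. *)
definition JLT :: "'w measure \<Rightarrow> ('w \<Rightarrow> real^'n^'m) \<Rightarrow> real \<Rightarrow> real \<Rightarrow> nat \<Rightarrow> bool" where
  "JLT M S \<epsilon> \<delta> k \<longleftrightarrow>
     prob_space M \<and> S \<in> borel_measurable M \<and> 0 < \<epsilon> \<and> 0 < \<delta> \<and> \<delta> < 1 \<and>
     (\<forall>V. finite V \<and> card V = k \<longrightarrow>
        measure M {\<omega> \<in> space M. \<forall>v\<in>V. \<forall>w\<in>V.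
          \<bar>(S \<omega> *v v) \<bullet> (S \<omega> *v w) - v \<bullet> w\<bar> \<le> \<epsilon> * norm v * norm w} \<ge> 1 - \<delta>)"

end

theory Submission
  imports Defs
begin

text \<open>
  Take \<open>V\<close> to consist of the orthonormal eigenvectors, for nonzero eigenvalues, of \<open>A\<close>, \<open>\<rho>\<close> and
  all \<open>B\<^sub>i\<close>; the bound on \<open>k\<close> makes room for them. If \<open>T\<close> preserves inner products on \<open>V\<close> up to
  \<open>\<epsilon>\<close>, then each \<open>\<langle>T u, T v\<rangle>\<^sup>2\<close> differs from \<open>\<langle>u, v\<rangle>\<^sup>2\<close> by at most \<open>\<epsilon> (2 + \<epsilon>)\<close>, and expanding in
  eigenvectors shows that \<open>Tr (T \<rho> T\<^sup>T T B\<^sub>i T\<^sup>T)\<close> differs from \<open>Tr (\<rho> B\<^sub>i)\<close> by at most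
  \<open>\<epsilon> (2 + \<epsilon>)\<close> times the Schatten norm of \<open>B\<^sub>i\<close>, which is less than \<open>\<bar>Tr (\<rho> B\<^sub>i)\<bar>\<close>; likewise for
  \<open>A\<close>. Hence all signs survive and the positive semidefinite \<open>T \<rho> T\<^sup>T\<close> certifies infeasibility.
  The spectral theorem is obtained by maximising the quadratic form over the unit sphere of an
  invariant subspace.
\<close>

section \<open>Spectral theorem on invariant subspaces\<close>

lemma inner_symmetric_matrix:
  fixes A :: "real^'n^'n"
  assumes "transpose A = A"
  shows "x \<bullet> (A *v y) = (A *v x) \<bullet> y"
  by (metis assms dot_lmul_matrix vector_transpose_matrix)

text \<open>A maximiser \<open>v\<close> of the quadratic form on the unit sphere of
  \<open>W\<close> is an eigenvector: otherwise moving from \<open>v\<close> along the residual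
  \<open>A *v v - q v *\<^sub>R v\<close>, which stays in \<open>W\<close> by invariance, would
  increase the Rayleigh quotient.\<close>

lemma symmetric_eigenvector_exists:
  fixes A :: "real^'n^'n"
  assumes sym: "transpose A = A"
    and W: "subspace W" "\<And>x. x \<in> W \<Longrightarrow> A *v x \<in> W" "W \<noteq> {0}"
  obtains v \<mu> where "v \<in> W" "norm v = 1" "A *v v = \<mu> *\<^sub>R v"
proof -
  let ?K = "W \<inter> sphere 0 1"
  define q where "q x = x \<bullet> (A *v x)" for x
  obtain w where w: "w \<in> W" "w \<noteq> 0"
    using W(1,3) subspace_0 by blast
  have "w /\<^sub>R norm w \<in> ?K"
    using w W(1) by (auto intro: subspace_scale)
  moreover have "compact ?K"
    using closed_subspace[OF W(1)] by (intro closed_Int_compact) auto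
  moreover have "continuous_on ?K q"
    unfolding q_def by (intro continuous_intros)
  ultimately obtain v where v: "v \<in> ?K" and max: "\<And>y. y \<in> ?K \<Longrightarrow> q y \<le> q v"
    using continuous_attains_sup[of ?K q] by blast
  have nv: "norm v = 1" and vW: "v \<in> W"
    using v by auto
  have vv: "v \<bullet> v = 1"
    using nv by (simp add: dot_square_norm)
  have bound: "q x \<le> q v * (x \<bullet> x)" if "x \<in> W" for x
  proof (cases "x = 0")
    case False
    then have "x /\<^sub>R norm x \<in> ?K"
      using that W(1) by (auto intro: subspace_scale)
    from max[OF this] have "q x / (norm x * norm x) \<le> q v"
      by (simp add: q_def matrix_vector_mult_scaleR divide_inverse mult_ac)
    then show ?thesis
      using False by (simp add: dot_square_norm power2_eq_square field_simps)
  qed (simp add: q_def)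
  \<comment> \<open>Half the gradient of \<open>q\<close> at \<open>v\<close>, projected onto the
    tangent space of the sphere; the goal is \<open>r = 0\<close>.\<close>
  define r where "r = A *v v - q v *\<^sub>R v"
  have r: "r \<in> W" "v \<bullet> r = 0"
    using W vW by (auto simp: r_def q_def inner_diff_right vv intro!: subspace_diff subspace_scale)
  have "r \<bullet> r = (A *v v) \<bullet> r - q v * (v \<bullet> r)"
    by (subst (1) r_def) (simp add: inner_diff_left)
  then have Avr: "(A *v v) \<bullet> r = r \<bullet> r"
    using r(2) by simp
  let ?c = "q v * (r \<bullet> r) - q r"
  \<comment> \<open>This is \<open>bound\<close> at \<open>v + t *\<^sub>R r\<close>, expanded: the
    constant terms cancel, and a term linear in \<open>t\<close> is bounded by a quadratic
    one.\<close>
  have ineq: "2 * t * (r \<bullet> r) \<le> t\<^sup>2 * ?c" for t :: real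
  proof -
    have "v + t *\<^sub>R r \<in> W"
      using W(1) vW r(1) by (auto intro: subspace_add subspace_scale)
    from bound[OF this] show ?thesis
      using r(2) Avr inner_symmetric_matrix[OF sym, of v r]
      by (simp add: q_def matrix_vector_right_distrib matrix_vector_mult_scaleR inner_add_left
          inner_add_right vv algebra_simps power2_eq_square inner_commute)
  qed
  have "r \<bullet> r = 0"
  proof (rule ccontr)
    assume "r \<bullet> r \<noteq> 0"
    then have pos: "r \<bullet> r > 0"
      by (simp add: order_less_le)
    \<comment> \<open>Small enough that \<open>t * ?c\<close> cannot exceed
      \<open>r \<bullet> r\<close>; the added 1 keeps the denominator positive.\<close>
    define t where "t = (r \<bullet> r) / (\<bar>?c\<bar> + 1)"
    have t: "t > 0" "t * (\<bar>?c\<bar> + 1) = r \<bullet> r"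
      using pos by (auto simp: t_def intro!: divide_pos_pos)
    have "t * (2 * (r \<bullet> r)) \<le> t * (t * ?c)"
      using ineq[of t] by (simp add: power2_eq_square mult_ac)
    then have "2 * (r \<bullet> r) \<le> t * ?c"
      using t(1) by (simp only: mult_le_cancel_left_pos)
    also have "\<dots> \<le> t * (\<bar>?c\<bar> + 1)"
      using t(1) by (intro mult_left_mono) auto
    also note t(2)
    finally show False
      using pos by simp
  qed
  then have "A *v v = q v *\<^sub>R v"
    by (simp add: r_def)
  with vW nv show thesis
    by (rule that)
qed

lemma inner_orthonormal:
  assumes "pairwise orthogonal E" "\<And>v. v \<in> E \<Longrightarrow> norm v = 1" "v \<in> E" "w \<in> E"
  shows "v \<bullet> w = (if v = w then 1 else 0)"
  using assms by (auto simp: pairwise_def orthogonal_def dot_square_norm)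

text \<open>Induction on the dimension: split off one unit eigenvector \<open>v\<close>. By symmetry
  of \<open>A\<close> the orthogonal complement of \<open>v\<close> in \<open>W\<close> is again
  invariant, and it has smaller dimension.\<close>

lemma symmetric_orthonormal_eigenvectors:
  fixes A :: "real^'n^'n"
  assumes sym: "transpose A = A"
    and "subspace W" "\<And>x. x \<in> W \<Longrightarrow> A *v x \<in> W"
  shows "\<exists>E \<mu>. finite E \<and> E \<subseteq> W \<and> pairwise orthogonal E \<and> (\<forall>v\<in>E. norm v = 1) \<and>
           (\<forall>x\<in>W. A *v x = (\<Sum>v\<in>E. (\<mu> v * (v \<bullet> x)) *\<^sub>R v))"
  using assms(2,3)
proof (induction "dim W" arbitrary: W rule: less_induct)
  case (less W)
  show ?case
  proof (cases "W = {0}")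
    case True
    then show ?thesis
      by (intro exI[of _ "{}"]) auto
  next
    case False
    obtain v a where v: "v \<in> W" "norm v = 1" "A *v v = a *\<^sub>R v"
      using symmetric_eigenvector_exists[OF sym less.prems(1) less.prems(2) False] by blast
    have vv: "v \<bullet> v = 1"
      using v(2) by (simp add: dot_square_norm)
    define U where "U = W \<inter> {x. v \<bullet> x = 0}"
    have sU: "subspace U"
      unfolding U_def by (intro subspace_inter less.prems subspace_hyperplane)
    have "v \<notin> U"
      by (simp add: U_def vv)
    moreover have "U \<subseteq> W"
      by (simp add: U_def)
    ultimately have "U \<subset> W"
      using v(1) by blast
    then have "dim U < dim W"
      using sU less.prems(1) by (metis dim_psubset span_eq_iff)
    moreover have "A *v x \<in> U" if "x \<in> U" for x
      using that less.prems(2) by (auto simp: U_def inner_symmetric_matrix[OF sym] v(3))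
    ultimately obtain E \<mu> where E: "finite E" "E \<subseteq> U" "pairwise orthogonal E" "\<forall>v\<in>E. norm v = 1"
      and dec: "\<And>x. x \<in> U \<Longrightarrow> A *v x = (\<Sum>v\<in>E. (\<mu> v * (v \<bullet> x)) *\<^sub>R v)"
      using less.hyps[of U] sU by blast
    have vE: "v \<notin> E"
      using E(2) \<open>v \<notin> U\<close> by blast
    have orth: "w \<bullet> v = 0" if "w \<in> E" for w
      using that E(2) by (auto simp: U_def inner_commute)
    have "A *v x = (\<Sum>w\<in>insert v E. ((\<mu>(v := a)) w * (w \<bullet> x)) *\<^sub>R w)" if "x \<in> W" for x
    proof -
      \<comment> \<open>The component of \<open>x\<close> orthogonal to \<open>v\<close>, to which
        the expansion on \<open>U\<close> applies. Replacing \<open>y\<close> by \<open>x\<close>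
        there changes no coefficient, since \<open>E\<close> is orthogonal to
        \<open>v\<close>.\<close>
      define y where "y = x - (v \<bullet> x) *\<^sub>R v"
      have "y \<in> U"
        using that v(1) less.prems(1) 
        by (auto simp: U_def y_def inner_diff_right vv intro: subspace_diff subspace_scale)
      have "A *v x = A *v y + (v \<bullet> x) *\<^sub>R A *v v"
        by (simp add: y_def matrix_vector_mult_diff_distrib matrix_vector_mult_scaleR
            scaleR_matrix_vector_assoc)
      also have "A *v y = (\<Sum>w\<in>E. (\<mu> w * (w \<bullet> x)) *\<^sub>R w)"
        unfolding dec[OF \<open>y \<in> U\<close>]
        by (intro sum.cong) (auto simp: y_def inner_diff_right orth)
      also have "\<dots> = (\<Sum>w\<in>E. ((\<mu>(v := a)) w * (w \<bullet> x)) *\<^sub>R w)"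
        using vE by (intro sum.cong) auto
      finally show ?thesis
        using E(1) vE v(3) by (simp add: mult.commute scaleR_matrix_vector_assoc[symmetric])
    qed
    moreover have "pairwise orthogonal (insert v E)"
      using E(3) orth by (auto simp: pairwise_insert orthogonal_def inner_commute)
    ultimately show ?thesis
      using E v \<open>U \<subset> W\<close>
      by (intro exI[of _ "insert v E"] exI[of _ "\<mu>(v := a)"]) auto
  qed
qed

section \<open>Rank-one expansions and spectral decompositions\<close>

definition outer :: "real^'m \<Rightarrow> real^'n \<Rightarrow> real^'n^'m" where
  "outer u v = (\<chi> i j. u $ i * v $ j)"

lemma outer_mult_vector: "outer u v *v x = (v \<bullet> x) *\<^sub>R u"
  by (simp add: outer_def matrix_vector_mult_def vec_eq_iff inner_vec_def sum_distrib_left mult_ac)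

lemma transpose_outer: "transpose (outer u v) = outer v u"
  by (simp add: outer_def transpose_def vec_eq_iff mult.commute)

lemma matrix_mult_outer: "P ** outer u v = outer (P *v u) v"
  by (simp add: outer_def matrix_matrix_mult_def matrix_vector_mult_def vec_eq_iff
      sum_distrib_right sum_distrib_left mult_ac)

lemma outer_mult_transpose: "outer u v ** transpose P = outer u (P *v v)"
  by (simp add: outer_def matrix_matrix_mult_def matrix_vector_mult_def transpose_def vec_eq_iff
      sum_distrib_right sum_distrib_left mult_ac)

lemma trace_outer: "trace (outer u v) = u \<bullet> v"
  by (simp add: outer_def trace_def inner_vec_def)

lemma linear_trace: "linear (trace :: real^'n^'n \<Rightarrow> real)"
  by (rule linearI) (simp_all add: trace_def sum.distrib sum_distrib_left)

lemma linear_matrix_mult_left: "linear (\<lambda>P :: real^'n^'m. P ** (Q :: real^'k^'n))"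
  by (rule linearI) (simp_all add: matrix_matrix_mult_def vec_eq_iff sum.distrib sum_distrib_left algebra_simps)

lemma linear_matrix_mult_right: "linear (\<lambda>Q :: real^'k^'n. (P :: real^'n^'m) ** Q)"
  by (rule linearI) (simp_all add: matrix_add_ldistrib matrix_scalar_ac scalar_matrix_assoc)

lemma linear_matrix_vector_mult_left: "linear (\<lambda>P :: real^'n^'m. P *v x)"
  by (rule linearI) (simp_all add: matrix_vector_mult_add_rdistrib scaleR_matrix_vector_assoc)

lemma linear_transpose: "linear (transpose :: real^'n^'m \<Rightarrow> real^'m^'n)"
  by (rule linearI) (simp_all add: transpose_def vec_eq_iff)

text \<open>The vectors \<open>f v\<close> are kept apart from the index set \<open>E\<close>, so
  that conjugation by \<open>T\<close> only replaces \<open>f\<close> by \<open>T *v f v\<close>,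
  even if \<open>T\<close> maps several indices to the same vector.\<close>

definition outer_sum :: "('a \<Rightarrow> real) \<Rightarrow> ('a \<Rightarrow> real^'n) \<Rightarrow> 'a set \<Rightarrow> real^'n^'n" where
  "outer_sum \<mu> f E = (\<Sum>v\<in>E. \<mu> v *\<^sub>R outer (f v) (f v))"

lemma outer_sum_mult_vector: "outer_sum \<mu> f E *v x = (\<Sum>v\<in>E. (\<mu> v * (f v \<bullet> x)) *\<^sub>R f v)"
  unfolding outer_sum_def
  by (simp add: linear_sum[OF linear_matrix_vector_mult_left]
      scaleR_matrix_vector_assoc[symmetric] outer_mult_vector)

lemma transpose_outer_sum: "transpose (outer_sum \<mu> f E) = outer_sum \<mu> f E"
  unfolding outer_sum_def
  by (simp add: linear_sum[OF linear_transpose] linear_scale[OF linear_transpose] transpose_outer)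

lemma trace_outer_sum: "trace (outer_sum \<mu> f E) = (\<Sum>v\<in>E. \<mu> v * (f v \<bullet> f v))"
  unfolding outer_sum_def
  by (simp add: linear_sum[OF linear_trace] linear_scale[OF linear_trace] trace_outer)

lemma conjugate_outer_sum: "T ** outer_sum \<mu> f E ** transpose T = outer_sum \<mu> (\<lambda>v. T *v f v) E"
  unfolding outer_sum_def
  by (simp add: linear_sum[OF linear_matrix_mult_left] linear_sum[OF linear_matrix_mult_right]
      linear_scale[OF linear_matrix_mult_left] linear_scale[OF linear_matrix_mult_right]
      matrix_mult_outer outer_mult_transpose)

lemma trace_mult_outer_sum: "trace (P ** outer_sum \<mu> f E) = (\<Sum>v\<in>E. \<mu> v * (f v \<bullet> (P *v f v)))"
  unfolding outer_sum_def
  by (simp add: linear_sum[OF linear_matrix_mult_right] linear_scale[OF linear_matrix_mult_right]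
      linear_sum[OF linear_trace] linear_scale[OF linear_trace] matrix_mult_outer trace_outer
      inner_commute)

lemma inner_outer_sum_mult: "x \<bullet> (outer_sum \<mu> f E *v y) = (\<Sum>v\<in>E. \<mu> v * (f v \<bullet> x) * (f v \<bullet> y))"
  by (simp add: outer_sum_mult_vector inner_sum_right inner_commute mult_ac)

lemma outer_sum_psd:
  assumes "\<And>v. v \<in> E \<Longrightarrow> 0 \<le> \<mu> v"
  shows "outer_sum \<mu> f E \<in> psd_cone"
  using assms
  by (auto simp: psd_cone_def transpose_outer_sum inner_outer_sum_mult mult.assoc intro!: sum_nonneg)

text \<open>Eigenvectors for the eigenvalue \<open>0\<close> are left out, so that \<open>card E \<le> rank A\<close>.\<close>

definition spectral_decomposition :: "real^'n^'n \<Rightarrow> (real^'n) set \<Rightarrow> (real^'n \<Rightarrow> real) \<Rightarrow> bool" where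
  "spectral_decomposition A E \<mu> \<longleftrightarrow> finite E \<and> pairwise orthogonal E \<and>
     (\<forall>v\<in>E. norm v = 1 \<and> \<mu> v \<noteq> 0) \<and> A = outer_sum \<mu> id E"

theorem spectral_decomposition_exists:
  fixes A :: "real^'n^'n"
  assumes "transpose A = A"
  obtains E \<mu> where "spectral_decomposition A E \<mu>"
proof -
  obtain E \<mu> where E: "finite E" "pairwise orthogonal E" "\<forall>v\<in>E. norm v = 1"
      "\<And>x. A *v x = (\<Sum>v\<in>E. (\<mu> v * (v \<bullet> x)) *\<^sub>R v)"
    using symmetric_orthonormal_eigenvectors[OF assms, of UNIV] by auto
  let ?E = "{v \<in> E. \<mu> v \<noteq> 0}"
  have "A *v x = outer_sum \<mu> id ?E *v x" for x
    unfolding outer_sum_mult_vector E(4) using E(1) by (intro sum.mono_neutral_cong_right) auto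
  then have "A = outer_sum \<mu> id ?E"
    by (simp add: matrix_eq)
  moreover have "pairwise orthogonal ?E"
    using E(2) by (rule pairwise_mono) auto
  ultimately have "spectral_decomposition A ?E \<mu>"
    using E by (simp add: spectral_decomposition_def)
  then show thesis
    by (rule that)
qed

lemma spectral_decomposition_inner:
  assumes "spectral_decomposition A E \<mu>" "v \<in> E" "w \<in> E"
  shows "v \<bullet> w = (if v = w then 1 else 0)"
  using assms by (intro inner_orthonormal[of E]) (auto simp: spectral_decomposition_def)

lemma spectral_decomposition_eigenvector:
  assumes "spectral_decomposition A E \<mu>" "v \<in> E"
  shows "A *v v = \<mu> v *\<^sub>R v"
proof -
  have "A *v v = (\<Sum>w\<in>E. (\<mu> w * (w \<bullet> v)) *\<^sub>R w)"
    using assms(1) by (simp add: spectral_decomposition_def outer_sum_mult_vector)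
  also have "\<dots> = (\<Sum>w\<in>E. if w = v then \<mu> v *\<^sub>R v else 0)"
    using assms by (intro sum.cong) (auto simp: spectral_decomposition_inner)
  finally show ?thesis
    using assms by (simp add: spectral_decomposition_def)
qed

lemma spectral_decomposition_trace:
  assumes "spectral_decomposition A E \<mu>"
  shows "trace A = (\<Sum>v\<in>E. \<mu> v)"
proof -
  have "A = outer_sum \<mu> id E"
    using assms by (simp add: spectral_decomposition_def)
  then have "trace A = (\<Sum>v\<in>E. \<mu> v * (v \<bullet> v))"
    by (simp add: trace_outer_sum)
  then show ?thesis
    using assms by (simp add: spectral_decomposition_inner cong: sum.cong)
qed

text \<open>Eigenvectors for nonzero eigenvalues lie in the range of \<open>A\<close>, and
  orthonormality makes them independent.\<close>

lemma spectral_decomposition_card: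
  assumes "spectral_decomposition A E \<mu>"
  shows "card E \<le> rank A"
proof -
  have "v \<in> range ((*v) A)" if "v \<in> E" for v
  proof -
    have "A *v (v /\<^sub>R \<mu> v) = v"
      using assms that spectral_decomposition_eigenvector[OF assms that]
      by (simp add: matrix_vector_mult_scaleR spectral_decomposition_def)
    then show ?thesis
      by (metis rangeI)
  qed
  moreover have "independent E"
    using assms by (intro pairwise_orthogonal_independent) (auto simp: spectral_decomposition_def)
  ultimately show ?thesis
    unfolding rank_dim_range by (intro independent_card_le_dim) auto
qed

lemma spectral_decomposition_psd_pos:
  assumes "spectral_decomposition P E \<mu>" "P \<in> psd_cone" "v \<in> E"
  shows "0 < \<mu> v"
proof -
  have "0 \<le> v \<bullet> (P *v v)"
    using assms(2) by (simp add: psd_cone_def)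
  also have "\<dots> = \<mu> v"
    using assms by (simp add: spectral_decomposition_eigenvector spectral_decomposition_inner)
  finally show ?thesis
    using assms by (force simp: spectral_decomposition_def)
qed

section \<open>Positive semidefinite roots and the Schatten norm\<close>

lemma psd_square_root_unique:
  fixes P Q :: "real^'n^'n"
  assumes P: "P \<in> psd_cone" and Q: "Q \<in> psd_cone" and eq: "P ** P = Q ** Q"
  shows "P = Q"
proof -
  have sym: "transpose P = P" "transpose Q = Q"
    using P Q by (auto simp: psd_cone_def)
  have "transpose (P - Q) = P - Q"
    using sym by (simp add: linear_diff[OF linear_transpose])
  then obtain E \<mu> where E: "spectral_decomposition (P - Q) E \<mu>"
    by (rule spectral_decomposition_exists)
  have "False" if v: "v \<in> E" for v
  proof -
    \<comment> \<open>\<open>P (P - Q) + (P - Q) Q = P\<^sup>2 - Q\<^sup>2\<close>, tested on an eigenvector of \<open>P - Q\<close>\<close>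
    have D: "(P - Q) *v v = \<mu> v *\<^sub>R v"
      by (rule spectral_decomposition_eigenvector[OF E v])
    have "\<mu> v * (v \<bullet> (P *v v) + v \<bullet> (Q *v v)) = v \<bullet> (P *v ((P - Q) *v v)) + ((P - Q) *v v) \<bullet> (Q *v v)"
      by (simp add: D matrix_vector_mult_scaleR distrib_left)
    also have "\<dots> = v \<bullet> (P *v (P *v v)) - v \<bullet> (Q *v (Q *v v))"
      using inner_symmetric_matrix[OF sym(1), of v "Q *v v"] inner_symmetric_matrix[OF sym(2), of v "Q *v v"]
      by (simp add: matrix_vector_mult_diff_rdistrib matrix_vector_mult_diff_distrib
          inner_diff_left inner_diff_right)
    also have "\<dots> = 0"
      by (simp add: matrix_vector_mul_assoc eq)
    \<comment> \<open>As \<open>\<mu> v\<close> is nonzero, the two nonnegative forms sum to zero,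
      so both vanish at \<open>v\<close>; their difference there is \<open>\<mu> v\<close>, a
      contradiction.\<close>
    finally have "v \<bullet> (P *v v) + v \<bullet> (Q *v v) = 0"
      using E v by (simp add: spectral_decomposition_def)
    moreover have "0 \<le> v \<bullet> (P *v v)" "0 \<le> v \<bullet> (Q *v v)"
      using P Q by (auto simp: psd_cone_def)
    ultimately have "v \<bullet> ((P - Q) *v v) = 0"
      by (simp add: matrix_vector_mult_diff_rdistrib inner_diff_right)
    then show False
      using E v by (simp add: D spectral_decomposition_inner) (simp add: spectral_decomposition_def)
  qed
  then have "E = {}"
    by blast
  then have "P - Q = 0"
    using E by (simp add: spectral_decomposition_def outer_sum_def)
  then show ?thesis
    by simp
qed

lemma psd_sqrt_eqI:
  assumes "R \<in> psd_cone" "R ** R = P"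
  shows "psd_sqrt P = R"
  unfolding psd_sqrt_def using assms psd_square_root_unique by (intro the_equality) auto

text \<open>Replacing each eigenvalue by its absolute value, on the same eigenvectors, gives a
  positive semidefinite root of \<open>A ** A\<close>, hence by uniqueness the root in the
  definition of the norm.\<close>

lemma schatten1_norm_spectral:
  assumes "spectral_decomposition A E \<mu>"
  shows "schatten1_norm A = (\<Sum>v\<in>E. \<bar>\<mu> v\<bar>)"
proof -
  let ?R = "outer_sum (\<lambda>v. \<bar>\<mu> v\<bar>) id E"
  have A: "A = outer_sum \<mu> id E"
    using assms by (simp add: spectral_decomposition_def)
  have R: "spectral_decomposition ?R E (\<lambda>v. \<bar>\<mu> v\<bar>)"
    using assms by (simp add: spectral_decomposition_def)
  have "?R ** ?R = A ** A"
  proof -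
    have "?R *v (?R *v x) = A *v (A *v x)" for x
    proof -
      have "?R *v (?R *v x) = (\<Sum>v\<in>E. (\<bar>\<mu> v\<bar> * (v \<bullet> x)) *\<^sub>R (?R *v v))"
        by (subst (2) outer_sum_mult_vector)
          (simp add: linear_sum[OF matrix_vector_mul_linear] matrix_vector_mult_scaleR)
      also have "\<dots> = (\<Sum>v\<in>E. (\<mu> v * (v \<bullet> x)) *\<^sub>R (A *v v))"
        by (intro sum.cong) (simp_all add: spectral_decomposition_eigenvector[OF R]
            spectral_decomposition_eigenvector[OF assms] mult_ac)
      also have "\<dots> = A *v (A *v x)"
        by (subst (3) A) (simp add: outer_sum_mult_vector
            linear_sum[OF matrix_vector_mul_linear] matrix_vector_mult_scaleR)
      finally show ?thesis .
    qed
    then show ?thesis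
      by (simp add: matrix_eq matrix_vector_mul_assoc)
  qed
  moreover have "transpose A = A"
    by (simp add: A transpose_outer_sum)
  ultimately have "psd_sqrt (transpose A ** A) = ?R"
    by (intro psd_sqrt_eqI outer_sum_psd) auto
  then show ?thesis
    by (simp add: schatten1_norm_def spectral_decomposition_trace[OF R])
qed

section \<open>Stability of traces of products under conjugation\<close>

text \<open>The trace depends on the vectors only through their mutual inner products, which are
  what a Johnson-Lindenstrauss map nearly preserves.\<close>

lemma trace_mult_outer_sum_outer_sum:
  "trace (outer_sum w f U ** outer_sum \<mu> g E) =
     (\<Sum>v\<in>E. \<Sum>u\<in>U. \<mu> v * (w u * (f u \<bullet> g v)\<^sup>2))"
  by (simp add: trace_mult_outer_sum inner_outer_sum_mult sum_distrib_left power2_eq_square mult_ac)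

text \<open>The inner sum is \<open>\<mu> v\<close> times a convex combination of values bounded by
  \<open>C\<close>. It serves both for the squared inner products and for their
  perturbations.\<close>

lemma abs_weighted_double_sum_le:
  fixes w \<mu> :: "'a \<Rightarrow> real"
  assumes "\<And>u. u \<in> U \<Longrightarrow> 0 \<le> w u" "sum w U = 1"
    and "\<And>u v. u \<in> U \<Longrightarrow> v \<in> E \<Longrightarrow> \<bar>d u v\<bar> \<le> C"
  shows "\<bar>\<Sum>v\<in>E. \<Sum>u\<in>U. \<mu> v * (w u * d u v)\<bar> \<le> C * (\<Sum>v\<in>E. \<bar>\<mu> v\<bar>)"
proof -
  have "\<bar>\<Sum>v\<in>E. \<Sum>u\<in>U. \<mu> v * (w u * d u v)\<bar> \<le> (\<Sum>v\<in>E. \<Sum>u\<in>U. \<bar>\<mu> v * (w u * d u v)\<bar>)"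
    by (intro order_trans[OF sum_abs] sum_mono sum_abs)
  also have "\<dots> \<le> (\<Sum>v\<in>E. \<Sum>u\<in>U. \<bar>\<mu> v\<bar> * (w u * C))"
    using assms by (intro sum_mono) (auto simp: abs_mult intro!: mult_left_mono)
  also have "\<dots> = C * (\<Sum>v\<in>E. \<bar>\<mu> v\<bar>)"
    using assms(2) by (simp flip: sum_distrib_left sum_distrib_right)
  finally show ?thesis .
qed

text \<open>Squared inner products of unit vectors are at most 1, and the eigenvalues of
  \<open>P\<close> are weights of total 1.\<close>

lemma trace_mult_le_schatten1_norm:
  assumes P: "spectral_decomposition P U w" "P \<in> psd_cone" "trace P = 1"
    and B: "spectral_decomposition B E \<mu>"
  shows "\<bar>trace (P ** B)\<bar> \<le> schatten1_norm B"
proof -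
  have "P = outer_sum w id U" "B = outer_sum \<mu> id E"
    using P(1) B by (simp_all add: spectral_decomposition_def)
  then have "trace (P ** B) = (\<Sum>v\<in>E. \<Sum>u\<in>U. \<mu> v * (w u * (u \<bullet> v)\<^sup>2))"
    by (simp add: trace_mult_outer_sum_outer_sum)
  moreover have "\<bar>(u \<bullet> v)\<^sup>2\<bar> \<le> 1" if "u \<in> U" "v \<in> E" for u v
    using that P(1) B Cauchy_Schwarz_ineq2[of u v]
    by (simp add: spectral_decomposition_def abs_square_le_1)
  ultimately show ?thesis
    using abs_weighted_double_sum_le[of U w E "\<lambda>u v. (u \<bullet> v)\<^sup>2" 1 \<mu>]
      spectral_decomposition_psd_pos[OF P(1,2)] spectral_decomposition_trace[OF P(1)] P(3)
    by (simp add: schatten1_norm_spectral[OF B] less_imp_le)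
qed

lemma trace_mult_conjugate_perturbation:
  fixes T :: "real^'n^'d"
  assumes P: "spectral_decomposition P U w" "P \<in> psd_cone" "trace P = 1"
    and B: "spectral_decomposition B E \<mu>"
    and T: "\<And>u v. u \<in> U \<Longrightarrow> v \<in> E \<Longrightarrow> \<bar>(T *v u) \<bullet> (T *v v) - u \<bullet> v\<bar> \<le> \<epsilon>"
  shows "\<bar>trace ((T ** P ** transpose T) ** (T ** B ** transpose T)) - trace (P ** B)\<bar>
           \<le> \<epsilon> * (2 + \<epsilon>) * schatten1_norm B"
proof -
  have eq: "P = outer_sum w id U" "B = outer_sum \<mu> id E"
    using P(1) B by (simp_all add: spectral_decomposition_def)
  let ?d = "\<lambda>u v. ((T *v u) \<bullet> (T *v v))\<^sup>2 - (u \<bullet> v)\<^sup>2"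
  have "trace ((T ** P ** transpose T) ** (T ** B ** transpose T)) - trace (P ** B) =
      (\<Sum>v\<in>E. \<Sum>u\<in>U. \<mu> v * (w u * ?d u v))"
    by (simp add: eq conjugate_outer_sum trace_mult_outer_sum_outer_sum right_diff_distrib
        sum_subtractf)
  moreover have "\<bar>?d u v\<bar> \<le> \<epsilon> * (2 + \<epsilon>)" if "u \<in> U" "v \<in> E" for u v
  proof -
    have "\<bar>u \<bullet> v\<bar> \<le> 1"
      using that P(1) B Cauchy_Schwarz_ineq2[of u v] by (simp add: spectral_decomposition_def)
    \<comment> \<open>Both inner products are controlled: one by 1 and the other by
      \<open>1 + \<epsilon>\<close>. The difference of squares then factors.\<close>
    then have "\<bar>(T *v u) \<bullet> (T *v v) + u \<bullet> v\<bar> \<le> 2 + \<epsilon>"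
      using T[OF that] by linarith
    moreover have "?d u v = ((T *v u) \<bullet> (T *v v) - u \<bullet> v) * ((T *v u) \<bullet> (T *v v) + u \<bullet> v)"
      by (simp add: power2_eq_square algebra_simps)
    ultimately show ?thesis
      using T[OF that] by (simp only: abs_mult) (intro mult_mono; linarith)
  qed
  ultimately show ?thesis
    using abs_weighted_double_sum_le[of U w E ?d "\<epsilon> * (2 + \<epsilon>)" \<mu>]
      spectral_decomposition_psd_pos[OF P(1,2)] spectral_decomposition_trace[OF P(1)] P(3)
    by (simp add: schatten1_norm_spectral[OF B] less_imp_le)
qed

text \<open>The trace is at most the Schatten norm, so the assumed bound forces
  \<open>\<epsilon> \<le> 1 / 6\<close>. Then \<open>2 + \<epsilon> \<le> 3\<close>, and the error
  is at most half of the absolute trace.\<close>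

lemma trace_mult_conjugate_perturbation_less:
  fixes T :: "real^'n^'d"
  assumes P: "spectral_decomposition P U w" "P \<in> psd_cone" "trace P = 1"
    and B: "spectral_decomposition B E \<mu>"
    and T: "\<And>u v. u \<in> U \<Longrightarrow> v \<in> E \<Longrightarrow> \<bar>(T *v u) \<bullet> (T *v v) - u \<bullet> v\<bar> \<le> \<epsilon>"
    and "trace (P ** B) \<noteq> 0" "0 < \<epsilon>"
    and \<epsilon>: "\<epsilon> \<le> 1 / 6 * \<bar>trace (P ** B) / schatten1_norm B\<bar>"
  shows "\<bar>trace ((T ** P ** transpose T) ** (T ** B ** transpose T)) - trace (P ** B)\<bar>
           < \<bar>trace (P ** B)\<bar>"
proof -
  let ?s = "schatten1_norm B"
  have le: "\<bar>trace (P ** B)\<bar> \<le> ?s"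
    by (rule trace_mult_le_schatten1_norm[OF P B])
  then have s: "0 < ?s"
    using assms(6) by linarith
  have es: "\<epsilon> * ?s \<le> 1 / 6 * \<bar>trace (P ** B)\<bar>"
    using \<epsilon> s by (simp add: field_simps)
  also have "\<dots> \<le> 1 / 6 * ?s"
    using le by simp
  finally have "\<epsilon> \<le> 1 / 6"
    using s by (simp only: mult_le_cancel_right_pos)
  then have "(2 + \<epsilon>) * (\<epsilon> * ?s) \<le> 3 * (\<epsilon> * ?s)"
    using \<open>0 < \<epsilon>\<close> s by (intro mult_right_mono) auto
  also have "\<dots> < \<bar>trace (P ** B)\<bar>"
    using es assms(6) by linarith
  finally show ?thesis
    using trace_mult_conjugate_perturbation[OF P B T] by (simp add: mult_ac)
qed

text \<open>Expanding \<open>Q\<close> in eigenvectors leaves a sum of positive eigenvalues times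
  values of the quadratic form of \<open>P\<close>.\<close>

lemma trace_mult_psd_nonneg:
  assumes "P \<in> psd_cone" "Q \<in> psd_cone"
  shows "0 \<le> trace (P ** Q)"
proof -
  have "transpose Q = Q"
    using assms(2) by (simp add: psd_cone_def)
  then obtain E \<mu> where E: "spectral_decomposition Q E \<mu>"
    by (rule spectral_decomposition_exists)
  then have "Q = outer_sum \<mu> id E"
    by (simp add: spectral_decomposition_def)
  moreover have "0 \<le> \<mu> v * (v \<bullet> (P *v v))" if "v \<in> E" for v
    using spectral_decomposition_psd_pos[OF E assms(2) that] assms(1)
    by (simp add: psd_cone_def less_imp_le)
  ultimately show ?thesis
    by (simp add: trace_mult_outer_sum sum_nonneg)
qed

lemma conjugate_psd:
  assumes "P \<in> psd_cone"
  shows "T ** P ** transpose T \<in> psd_cone"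
proof -
  have "x \<bullet> ((T ** P ** transpose T) *v x) = (transpose T *v x) \<bullet> (P *v (transpose T *v x))" for x
    by (simp flip: matrix_vector_mul_assoc)
      (metis dot_lmul_matrix transpose_matrix_vector)
  moreover have "transpose (T ** P ** transpose T) = T ** P ** transpose T"
    using assms by (simp add: psd_cone_def matrix_transpose_mul matrix_mul_assoc)
  ultimately show ?thesis
    using assms by (simp add: psd_cone_def)
qed

section \<open>Measurability of the infeasibility event\<close>

lemma continuous_on_matrix_mult [continuous_intros]:
  fixes P :: "'a::topological_space \<Rightarrow> real^'n^'m" and Q :: "'a \<Rightarrow> real^'k^'n"
  assumes "continuous_on X P" "continuous_on X Q"
  shows "continuous_on X (\<lambda>x. P x ** Q x)"
  unfolding matrix_matrix_mult_def using assms by (intro continuous_intros)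

lemma continuous_on_transpose [continuous_intros]:
  fixes P :: "'a::topological_space \<Rightarrow> real^'n^'m"
  assumes "continuous_on X P"
  shows "continuous_on X (\<lambda>x. transpose (P x))"
  unfolding transpose_def using assms by (intro continuous_intros)

lemma closed_psd_cone: "closed (psd_cone :: (real^'n^'n) set)"
proof -
  have "continuous_on UNIV (\<lambda>P :: real^'n^'n. P *v x)" for x
    by (intro linear_continuous_on linear_conv_bounded_linear[THEN iffD1]
        linear_matrix_vector_mult_left)
  then show ?thesis
    unfolding psd_cone_def
    by (intro closed_Collect_conj closed_Collect_all closed_Collect_eq closed_Collect_le
        continuous_intros)
qed

text \<open>The projection of a closed set need not be closed, but it is a countable union of compact
  sets.\<close>

lemma borel_fst_image_closed:
  fixes Z :: "('a::euclidean_space \<times> 'b::euclidean_space) set"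
  assumes "closed Z"
  shows "fst ` Z \<in> sets borel"
proof -
  have "\<exists>n. z \<in> cball 0 (real n)" for z :: "'a \<times> 'b"
    using real_arch_simple[of "norm z"] by simp
  then have "fst ` Z = (\<Union>n. fst ` (Z \<inter> cball 0 (real n)))"
    by blast
  moreover have "compact (Z \<inter> cball 0 (real n))" for n
    using assms by (rule closed_Int_compact) simp
  then have "fst ` (Z \<inter> cball 0 (real n)) \<in> sets borel" for n
    by (intro borel_closed compact_imp_closed compact_continuous_image continuous_intros)
  ultimately show ?thesis
    by auto
qed

text \<open>The feasible pairs \<open>(T, c)\<close> form a closed set, so its projection to
  \<open>T\<close> is Borel, and the set in question is the complement. Projecting avoids an
  uncountable intersection over \<open>c\<close>.\<close>

lemma sets_infeasible_conjugate:
  fixes A :: "real^'n^'n" and B :: "'m::finite \<Rightarrow> real^'n^'n"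
  shows "{T :: real^'n^'d. \<forall>c\<in>nonneg_orthant.
           (\<Sum>i\<in>UNIV. c $ i *\<^sub>R (T ** B i ** transpose T)) - T ** A ** transpose T \<notin> psd_cone}
         \<in> sets borel" (is "?N \<in> _")
proof -
  define h where "h z = (\<Sum>i\<in>UNIV. snd z $ i *\<^sub>R (fst z ** B i ** transpose (fst z)))
      - fst z ** A ** transpose (fst z)" for z :: "(real^'n^'d) \<times> (real^'m)"
  have "continuous_on UNIV h"
    unfolding h_def by (intro continuous_intros)
  then have "closed (h -` psd_cone)"
    by (intro closed_vimage closed_psd_cone)
  moreover have "closed {z :: (real^'n^'d) \<times> (real^'m). \<forall>i. 0 \<le> snd z $ i}"
    by (intro closed_Collect_all closed_Collect_le continuous_intros)
  ultimately have "fst ` ({z. \<forall>i. 0 \<le> snd z $ i} \<inter> h -` psd_cone) \<in> sets borel"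
    by (intro borel_fst_image_closed closed_Int)
  moreover have "T \<in> fst ` ({z. \<forall>i. 0 \<le> snd z $ i} \<inter> h -` psd_cone) \<longleftrightarrow>
      (\<exists>c\<in>nonneg_orthant. h (T, c) \<in> psd_cone)" for T
    by (auto simp: nonneg_orthant_def image_iff Bex_def)
  then have "?N = - fst ` ({z. \<forall>i. 0 \<le> snd z $ i} \<inter> h -` psd_cone)"
    by (auto simp: h_def)
  ultimately show ?thesis
    by (simp add: borel_comp)
qed

section \<open>Choice of the test set\<close>

lemma finite_superset_of_card:
  assumes "finite F" "card F \<le> k" "infinite (UNIV :: 'a set)"
  obtains V :: "'a set" where "F \<subseteq> V" "finite V" "card V = k"
proof -
  obtain G where G: "finite G" "card G = k - card F" "G \<subseteq> UNIV - F"
    using infinite_arbitrarily_large[of "UNIV - F" "k - card F"] assms by auto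
  then have "card (F \<union> G) = k"
    using assms by (subst card_Un_disjoint) auto
  then show thesis
    using G assms by (intro that[of "F \<union> G"]) auto
qed

text \<open>The rank bound leaves at most \<open>k\<close> eigenvectors in total; they are padded
  with arbitrary vectors because \<open>JLT\<close> speaks of sets with exactly \<open>k\<close>
  elements.\<close>

lemma spectral_decompositions_cover:
  fixes A P :: "real^'n^'n" and B :: "'m::finite \<Rightarrow> real^'n^'n"
  assumes "spectral_decomposition A F \<alpha>" "spectral_decomposition P U w"
    and "\<And>i. spectral_decomposition (B i) (E i) (\<mu> i)"
    and "rank A + rank P + (\<Sum>i\<in>UNIV. rank (B i)) \<le> k"
  obtains V where "finite V" "card V = k" "F \<subseteq> V" "U \<subseteq> V" "\<And>i. E i \<subseteq> V"
proof -
  have "card (F \<union> U \<union> (\<Union>i. E i)) \<le> card F + card U + (\<Sum>i\<in>UNIV. card (E i))"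
    by (intro order_trans[OF card_Un_le] add_mono card_UN_le) auto
  also have "\<dots> \<le> rank A + rank P + (\<Sum>i\<in>UNIV. rank (B i))"
    by (intro add_mono sum_mono spectral_decomposition_card[OF assms(1)]
        spectral_decomposition_card[OF assms(2)] spectral_decomposition_card[OF assms(3)])
  finally have card: "card (F \<union> U \<union> (\<Union>i. E i)) \<le> k"
    using assms(4) by linarith
  have fin: "finite (F \<union> U \<union> (\<Union>i. E i))"
    using assms(1-3) by (simp add: spectral_decomposition_def)
  have "infinite (UNIV :: (real^'n) set)"
    using finite_imp_bounded not_bounded_UNIV by blast
  then obtain V where "F \<union> U \<union> (\<Union>i. E i) \<subseteq> V" "finite V" "card V = k"
    using finite_superset_of_card[OF fin card] by blast
  then show thesis
    by (intro that[of V]) blast+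
qed

section \<open>Transfer of infeasibility to the projected matrices\<close>

theorem theorem4p2:
  fixes A \<rho> :: "real^'D^'D"
    and B :: "'m::finite \<Rightarrow> real^'D^'D"
    and M :: "'w measure"
    and S :: "'w \<Rightarrow> real^'D^'d"
    and \<epsilon> \<delta> :: real
    and k :: nat
  assumes "transpose A = A" and "A \<noteq> 0"
    and "\<And>i. transpose (B i) = B i" and "\<And>i. B i \<noteq> 0"
    and "\<And>c. c \<in> nonneg_orthant \<Longrightarrow> (\<Sum>i\<in>UNIV. c $ i *\<^sub>R B i) - A \<notin> psd_cone"
    and "pointed (matrix_cone B)"
    and "matrix_cone B \<inter> psd_cone = {0}"
    and "\<rho> \<in> psd_cone"
    and "\<And>i. trace (\<rho> ** B i) < 0"
    and "trace ((- A) ** \<rho>) < 0"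
    and "trace \<rho> = 1"
    and "\<epsilon> = 1 / 6 * Min (insert \<bar>trace (\<rho> ** A) / schatten1_norm A\<bar>
                           (range (\<lambda>i. \<bar>trace (\<rho> ** B i) / schatten1_norm (B i)\<bar>)))"
    and "JLT M S \<epsilon> \<delta> k"
    and "k \<ge> rank A + rank \<rho> + (\<Sum>i\<in>UNIV. rank (B i))"
  shows "measure M {\<omega> \<in> space M. \<forall>c \<in> nonneg_orthant.
           (\<Sum>i\<in>UNIV. c $ i *\<^sub>R (S \<omega> ** B i ** transpose (S \<omega>)))
             - S \<omega> ** A ** transpose (S \<omega>) \<notin> psd_cone} \<ge> 1 - \<delta>"
proof -
  have "prob_space M" and S: "S \<in> borel_measurable M" and "0 < \<epsilon>"
    using assms(13) by (auto simp: JLT_def)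
  interpret prob_space M by fact
  obtain F \<alpha> where F: "spectral_decomposition A F \<alpha>"
    using spectral_decomposition_exists assms(1) by blast
  have "transpose \<rho> = \<rho>"
    using assms(8) by (simp add: psd_cone_def)
  then obtain U w where U: "spectral_decomposition \<rho> U w"
    using spectral_decomposition_exists by blast
  have "\<forall>i. \<exists>E \<mu>. spectral_decomposition (B i) E \<mu>"
    using spectral_decomposition_exists assms(3) by blast
  then obtain E \<mu> where E: "\<And>i. spectral_decomposition (B i) (E i) (\<mu> i)"
    by metis
  obtain V where V: "finite V" "card V = k" "F \<subseteq> V" "U \<subseteq> V" "\<And>i. E i \<subseteq> V"
    using spectral_decompositions_cover[where B = B, OF F U E assms(14)] by blast
  let ?G = "{\<omega> \<in> space M. \<forall>v\<in>V. \<forall>w\<in>V.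
      \<bar>(S \<omega> *v v) \<bullet> (S \<omega> *v w) - v \<bullet> w\<bar> \<le> \<epsilon> * norm v * norm w}"
  let ?H = "{\<omega> \<in> space M. \<forall>c \<in> nonneg_orthant.
      (\<Sum>i\<in>UNIV. c $ i *\<^sub>R (S \<omega> ** B i ** transpose (S \<omega>)))
        - S \<omega> ** A ** transpose (S \<omega>) \<notin> psd_cone}"
  \<comment> \<open>Symmetry of the trace in its two factors brings the hypothesis on
    \<open>(- A) ** \<rho>\<close> to the order used for \<open>B i\<close>.\<close>
  have trA: "trace (\<rho> ** A) > 0"
    using assms(10) trace_mul_sym[of A \<rho>]
      linear_neg[OF linear_compose[OF linear_matrix_mult_left linear_trace], of \<rho> A]
    by (simp add: o_def)
  have epsA: "\<epsilon> \<le> 1 / 6 * \<bar>trace (\<rho> ** A) / schatten1_norm A\<bar>"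
    unfolding assms(12) by (intro mult_left_mono Min_le) auto
  have epsB: "\<epsilon> \<le> 1 / 6 * \<bar>trace (\<rho> ** B i) / schatten1_norm (B i)\<bar>" for i
    unfolding assms(12) by (intro mult_left_mono Min_le) auto
  have "?G \<subseteq> ?H"
  proof
    fix \<omega> assume \<omega>: "\<omega> \<in> ?G"
    define T where "T = S \<omega>"
    define Q where "Q = T ** \<rho> ** transpose T"
    have JL: "\<bar>(T *v u) \<bullet> (T *v v) - u \<bullet> v\<bar> \<le> \<epsilon>"
      if "spectral_decomposition C K \<kappa>" "K \<subseteq> V" "u \<in> U" "v \<in> K" for C K \<kappa> u v
    proof -
      have "u \<in> V" "v \<in> V" "norm u = 1" "norm v = 1"
        using that V(4) U by (auto simp: spectral_decomposition_def)
      then show ?thesis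
        using \<omega> unfolding T_def by fastforce
    qed
    have "\<bar>trace (Q ** (T ** B i ** transpose T)) - trace (\<rho> ** B i)\<bar> < \<bar>trace (\<rho> ** B i)\<bar>" for i
      unfolding Q_def using assms(9)[of i] \<open>0 < \<epsilon>\<close>
      by (intro trace_mult_conjugate_perturbation_less[OF U assms(8,11) E _ _ _ epsB] JL[OF E V(5)])
        auto
    \<comment> \<open>A perturbation smaller than the absolute value cannot change the sign; the
      same argument gives \<open>posA\<close>.\<close>
    then have negB: "trace (Q ** (T ** B i ** transpose T)) < 0" for i
      using assms(9)[of i] by (smt (verit))
    have "\<bar>trace (Q ** (T ** A ** transpose T)) - trace (\<rho> ** A)\<bar> < \<bar>trace (\<rho> ** A)\<bar>"
      unfolding Q_def using trA \<open>0 < \<epsilon>\<close>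
      by (intro trace_mult_conjugate_perturbation_less[OF U assms(8,11) F _ _ _ epsA] JL[OF F V(3)])
        auto
    then have posA: "0 < trace (Q ** (T ** A ** transpose T))"
      using trA by linarith
    \<comment> \<open>The functional \<open>trace (Q ** X)\<close> separates: it is nonnegative on
      the positive semidefinite cone, negative on each projected \<open>B i\<close> and positive on
      the projected \<open>A\<close>.\<close>
    have lin: "linear (\<lambda>X. trace (Q ** X))"
      using linear_compose[OF linear_matrix_mult_right linear_trace] by (simp add: o_def)
    have "(\<Sum>i\<in>UNIV. c $ i *\<^sub>R (T ** B i ** transpose T)) - T ** A ** transpose T \<notin> psd_cone"
      (is "?X \<notin> _") if "c \<in> nonneg_orthant" for c
    proof
      assume "?X \<in> psd_cone"
      then have "0 \<le> trace (Q ** ?X)"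
        unfolding Q_def by (intro trace_mult_psd_nonneg conjugate_psd assms(8))
      also have "trace (Q ** ?X) = (\<Sum>i\<in>UNIV. c $ i * trace (Q ** (T ** B i ** transpose T)))
          - trace (Q ** (T ** A ** transpose T))"
        by (simp only: linear_diff[OF lin] linear_sum[OF lin] linear_scale[OF lin] real_scaleR_def)
      also have "(\<Sum>i\<in>UNIV. c $ i * trace (Q ** (T ** B i ** transpose T))) \<le> 0"
        using that negB by (intro sum_nonpos mult_nonneg_nonpos)
          (auto simp: nonneg_orthant_def less_imp_le)
      finally show False
        using posA by linarith
    qed
    then show "\<omega> \<in> ?H"
      using \<omega> by (simp add: T_def)
  qed
  \<comment> \<open>Monotonicity of the measure asks for a measurable larger event;
    \<open>?H\<close> is the preimage under \<open>S\<close> of a Borel set of matrices.\<close>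
  moreover have "?H \<in> sets M"
    using measurable_sets[OF S sets_infeasible_conjugate[of B A]]
    by (simp add: vimage_def Int_def conj_commute)
  ultimately have "measure M ?G \<le> measure M ?H"
    by (rule finite_measure_mono)
  moreover have "1 - \<delta> \<le> measure M ?G"
    using assms(13) V(1,2) by (simp add: JLT_def)
  ultimately show ?thesis
    by linarith
qed

end
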